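(* Let $\phi_{\mathrm{PP}}^*$ and $\phi_{\mathrm{UP}}^*$ denote the optimal values of the personalized pricing problem PP and the uniform pricing problem UP, respectively. Then $\phi_{\mathrm{PP}}^*\le\phi_{\mathrm{UP}}^*$.
   Context: Let $N=\{1,\dots,n\}$. The given data are real numbers $a_i>0$, $m_i>0$, $b_i\in\mathbb{R}$ ($i\in N$), $p>0$, $f>0$ and $\bar\rho\ge 0$. For reals $s,t$, the notation $0\le s\perp t\ge 0$ means $s\ge 0$, $t\ge 0$ and $st=0$. Problem PP (personalized pricing), in the variables $x,y,\mu,\nu\in\mathbb{R}^n$: minimize $\sum_{i\in N}(x_i-p)y_i+pf$ subject to $\sum_{i\in N}y_i\le f$ and, for all $i\in N$: $0\le x_i\le\bar\rho$, $\ y_i=\frac{x_i-b_i+\mu_i-\nu_i}{a_i}$, $\ 0\le y_i\perp\mu_i\ge 0$, $\ 0\le m_i-y_i\perp\nu_i\ge 0$. Problem UP (uniform pricing), in the variables $x\in\mathbb{R}$ and $y,\mu,\nu\in\mathbb{R}^n$: minimize $\sum_{i\in N}(x-p)y_i+pf$ subject to $0\le x\le\bar\rho$, $\ \sum_{i\in N}y_i\le f$ and, for all $i\in N$: $\ y_i=\frac{x-b_i+\mu_i-\nu_i}{a_i}$, $\ 0\le y_i\perp\mu_i\ge 0$, $\ 0\le m_i-y_i\perp\nu_i\ge 0$. The optimal value is the infimum of the objective over the feasible set, with value $+\infty$ if the feasible set is empty. *)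

theory Defs
  imports "HOL-Analysis.Finite_Cartesian_Product" "HOL-Library.Extended_Real"
begin

(* The index set N = {1,...,n}, n >= 1, is the finite index type 'n, with n = CARD('n). *)

definition complementary :: "real \<Rightarrow> real \<Rightarrow> bool" where
  "complementary s t \<longleftrightarrow> s \<ge> 0 \<and> t \<ge> 0 \<and> s * t = 0"

definition PP_feasible ::
  "(real ^ 'n) \<Rightarrow> (real ^ 'n) \<Rightarrow> (real ^ 'n) \<Rightarrow> real \<Rightarrow> real \<Rightarrow>
   ((real ^ 'n) \<times> (real ^ 'n) \<times> (real ^ 'n) \<times> (real ^ 'n)) set" where
  "PP_feasible a m b f \<rho> =
    {(x, y, \<mu>, \<nu>).
       (\<Sum>i\<in>UNIV. y $ i) \<le> f \<and>
       (\<forall>i. 0 \<le> x $ i \<and> x $ i \<le> \<rho> \<and>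
            y $ i = (x $ i - b $ i + \<mu> $ i - \<nu> $ i) / a $ i \<and>
            complementary (y $ i) (\<mu> $ i) \<and>
            complementary (m $ i - y $ i) (\<nu> $ i))}"

definition PP_objective :: "real \<Rightarrow> real \<Rightarrow> (real ^ 'n) \<Rightarrow> (real ^ 'n) \<Rightarrow> real" where
  "PP_objective p f x y = (\<Sum>i\<in>UNIV. (x $ i - p) * y $ i) + p * f"

definition UP_feasible ::
  "(real ^ 'n) \<Rightarrow> (real ^ 'n) \<Rightarrow> (real ^ 'n) \<Rightarrow> real \<Rightarrow> real \<Rightarrow>
   (real \<times> (real ^ 'n) \<times> (real ^ 'n) \<times> (real ^ 'n)) set" where
  "UP_feasible a m b f \<rho> =
    {(x, y, \<mu>, \<nu>).
       0 \<le> x \<and> x \<le> \<rho> \<and>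
       (\<Sum>i\<in>UNIV. y $ i) \<le> f \<and>
       (\<forall>i. y $ i = (x - b $ i + \<mu> $ i - \<nu> $ i) / a $ i \<and>
            complementary (y $ i) (\<mu> $ i) \<and>
            complementary (m $ i - y $ i) (\<nu> $ i))}"

definition UP_objective :: "real \<Rightarrow> real \<Rightarrow> real \<Rightarrow> (real ^ 'n) \<Rightarrow> real" where
  "UP_objective p f x y = (\<Sum>i\<in>UNIV. (x - p) * y $ i) + p * f"

(* Optimal values are extended reals: the infimum over an empty feasible set is \<infinity>. *)

definition PP_value ::
  "(real ^ 'n) \<Rightarrow> (real ^ 'n) \<Rightarrow> (real ^ 'n) \<Rightarrow> real \<Rightarrow> real \<Rightarrow> real \<Rightarrow> ereal" where
  "PP_value a m b p f \<rho> =
     (INF (x, y, \<mu>, \<nu>) \<in> PP_feasible a m b f \<rho>. ereal (PP_objective p f x y))"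

definition UP_value ::
  "(real ^ 'n) \<Rightarrow> (real ^ 'n) \<Rightarrow> (real ^ 'n) \<Rightarrow> real \<Rightarrow> real \<Rightarrow> real \<Rightarrow> ereal" where
  "UP_value a m b p f \<rho> =
     (INF (x, y, \<mu>, \<nu>) \<in> UP_feasible a m b f \<rho>. ereal (UP_objective p f x y))"

end

theory Submission imports Defs begin

text \<open>Uniform pricing is personalized pricing with equal prices for all customers: the constant
  vector of a uniform price turns every UP-feasible point into a PP-feasible point with the same
  \<open>y\<close>, \<open>\<mu>\<close>, \<open>\<nu>\<close> and the same cost. So the infimum for PP is bounded by each value of the UP
  objective, and hence by their infimum; this includes the case of an infeasible UP, whose
  optimal value is \<open>\<infinity>\<close>.\<close>

lemma UP_feasible_imp_PP_feasible:
  assumes "(x, y, \<mu>, \<nu>) \<in> UP_feasible a m b f \<rho>"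
  shows "(vec x, y, \<mu>, \<nu>) \<in> PP_feasible a m b f \<rho>"
  using assms unfolding UP_feasible_def PP_feasible_def mem_Collect_eq prod.case vec_component by blast

lemma PP_objective_vec: "PP_objective p f (vec x) y = UP_objective p f x y"
  by (simp add: PP_objective_def UP_objective_def)

theorem proposition8:
  fixes a m b :: "real ^ 'n" and p f \<rho> :: real
  assumes "\<And>i. a $ i > 0"
    and "\<And>i. m $ i > 0"
    and "p > 0" and "f > 0" and "\<rho> \<ge> 0"
  shows "PP_value a m b p f \<rho> \<le> UP_value a m b p f \<rho>"
  unfolding UP_value_def
proof (rule INF_greatest, clarify)
  fix x y \<mu> \<nu>
  assume "(x, y, \<mu>, \<nu>) \<in> UP_feasible a m b f \<rho>"
  then have "(vec x, y, \<mu>, \<nu>) \<in> PP_feasible a m b f \<rho>"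
    by (rule UP_feasible_imp_PP_feasible)
  then have "PP_value a m b p f \<rho> \<le> ereal (PP_objective p f (vec x) y)"
    unfolding PP_value_def by (rule INF_lower2) simp
  then show "PP_value a m b p f \<rho> \<le> ereal (UP_objective p f x y)"
    by (simp add: PP_objective_vec)
qed

end
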